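(* Let $X$ be the triangle $K_3$. For every prolongation $\widetilde X$ of $X$ and for every graph $\widetilde Y$ on $|V(\widetilde X)|$ vertices with minimum degree at least $|V(\widetilde X)|-2$, the graph $\mathsf{FS}(\widetilde X,\widetilde Y)$ is connected.
   Context: All graphs are finite and simple. For graphs $X,Y$ with $|V(X)|=|V(Y)|$, the friends-and-strangers graph $\mathsf{FS}(X,Y)$ has as vertices all bijections $\sigma\colon V(X)\to V(Y)$; two bijections $\sigma,\sigma'$ are adjacent iff there is an edge $\{a,b\}\in E(X)$ with $\{\sigma(a),\sigma(b)\}\in E(Y)$, $\sigma(a)=\sigma'(b)$, $\sigma(b)=\sigma'(a)$, and $\sigma(c)=\sigma'(c)$ for all $c\in V(X)\setminus\{a,b\}$. A Hamiltonian path in a graph $G$ on $n$ vertices is a subgraph of $G$ isomorphic to the path graph on $n$ vertices. If $X$ is a graph with a Hamiltonian path, a prolongation of $X$ is a graph $\widetilde X$ such that: (1) $\widetilde X$ contains a (not necessarily induced) subgraph $X^\#$ isomorphic to $X$; and (2) $\widetilde X$ contains a Hamiltonian path that itself contains (as a subgraph) a Hamiltonian path of $X^\#$. *)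

theory Defs
  imports "Graph_Theory.Graph_Theory"
begin

text \<open>
  A finite simple graph is a \<^locale>\<open>pair_graph\<close>: a finite loop-free digraph whose arc set is
  symmetric, so that an edge is represented by its two orientations.
\<close>

text \<open>
  The vertices of the friends-and-strangers graph are the bijections between the two vertex sets.
  They are taken to be extensional (undefined outside the vertex set of the first graph), so that
  every bijection is represented by exactly one HOL function.
\<close>

definition fs_verts :: "'a pair_pre_digraph \<Rightarrow> 'b pair_pre_digraph \<Rightarrow> ('a \<Rightarrow> 'b) set" where
  "fs_verts X Y = {\<sigma> \<in> extensional (pverts X). bij_betw \<sigma> (pverts X) (pverts Y)}"

definition fs_adj ::
  "'a pair_pre_digraph \<Rightarrow> 'b pair_pre_digraph \<Rightarrow> ('a \<Rightarrow> 'b) \<Rightarrow> ('a \<Rightarrow> 'b) \<Rightarrow> bool" where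
  "fs_adj X Y \<sigma> \<tau> \<longleftrightarrow>
     (\<exists>a b. (a, b) \<in> parcs X \<and> (\<sigma> a, \<sigma> b) \<in> parcs Y \<and> \<sigma> a = \<tau> b \<and> \<sigma> b = \<tau> a \<and>
            (\<forall>c \<in> pverts X - {a, b}. \<sigma> c = \<tau> c))"

definition fs_graph ::
  "'a pair_pre_digraph \<Rightarrow> 'b pair_pre_digraph \<Rightarrow> ('a \<Rightarrow> 'b) pair_pre_digraph" where
  "fs_graph X Y =
     \<lparr> pverts = fs_verts X Y,
       parcs = {(\<sigma>, \<tau>). \<sigma> \<in> fs_verts X Y \<and> \<tau> \<in> fs_verts X Y \<and> fs_adj X Y \<sigma> \<tau>} \<rparr>"

definition path_graph :: "nat \<Rightarrow> nat pair_pre_digraph" where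
  "path_graph n =
     \<lparr> pverts = {..<n}, parcs = {(i, j). i < n \<and> j < n \<and> (j = Suc i \<or> i = Suc j)} \<rparr>"

text \<open>
  The library relation \<^const>\<open>subgraph\<close> does not ask the smaller digraph to be symmetric. Below,
  symmetry follows from being isomorphic to a graph.
\<close>

definition hamiltonian_path :: "'a pair_pre_digraph \<Rightarrow> 'a pair_pre_digraph \<Rightarrow> bool" where
  "hamiltonian_path P G \<longleftrightarrow>
     subgraph (with_proj P) (with_proj G) \<and>
     digraph_iso (with_proj P) (with_proj (path_graph (card (pverts G))))"

definition prolongation :: "'a pair_pre_digraph \<Rightarrow> 'b pair_pre_digraph \<Rightarrow> bool" where
  "prolongation Xt X \<longleftrightarrow>
     pair_graph Xt \<and>
     (\<exists>Xs. subgraph (with_proj Xs) (with_proj Xt) \<and>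
           digraph_iso (with_proj Xs) (with_proj X) \<and>
           (\<exists>Q P. hamiltonian_path Q Xt \<and> hamiltonian_path P Xs \<and>
                  subgraph (with_proj P) (with_proj Q)))"

text \<open>
  In a symmetric digraph without parallel arcs, the out-degree is the degree of the graph.
  The value is meaningful for finite graphs with at least one vertex.
\<close>

definition min_degree :: "'a pair_pre_digraph \<Rightarrow> nat" where
  "min_degree G = Min (out_degree (with_proj G) ` pverts G)"

lemma pair_graph_path_graph: "pair_graph (path_graph n)"
proof -
  have "finite (parcs (path_graph n))"
    by (rule finite_subset[of _ "{..<n} \<times> {..<n}"]) (auto simp: path_graph_def)
  then show ?thesis
    by unfold_locales (auto simp: path_graph_def symmetric_def sym_def)
qed

lemma pair_graph_fs_graph:
  assumes X: "pair_graph X" and Y: "pair_graph Y"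
  shows "pair_graph (fs_graph X Y)"
proof -
  interpret X: pair_graph X by fact
  interpret Y: pair_graph Y by fact
  have "fs_verts X Y \<subseteq> (\<Pi>\<^sub>E v \<in> pverts X. pverts Y)"
    by (auto simp: fs_verts_def PiE_def bij_betw_def)
  then have fin: "finite (fs_verts X Y)"
    by (rule finite_subset) (simp add: finite_PiE X.pair_finite_verts Y.pair_finite_verts)
  have fin': "finite (parcs (fs_graph X Y))"
    by (rule finite_subset[of _ "fs_verts X Y \<times> fs_verts X Y"]) (auto simp: fs_graph_def fin)
  have sym: "fs_adj X Y \<tau> \<sigma>" if "fs_adj X Y \<sigma> \<tau>" for \<sigma> \<tau>
    using that unfolding fs_adj_def by (metis Y.arcs_symmetric)
  have irrefl: "\<not> fs_adj X Y \<sigma> \<sigma>" for \<sigma>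
    unfolding fs_adj_def using Y.no_loops' by metis
  show ?thesis
    using fin fin' sym irrefl
    by unfold_locales (auto simp: fs_graph_def symmetric_def sym_def)
qed

end

theory Submission
  imports Defs "HOL-Combinatorics.Permutations"
begin

text \<open>
  Read a bijection as a placement of people (the vertices of \<open>Y\<close>) on the positions given by the
  vertices of \<open>X\<close>; a move lets two friends on adjacent positions trade places. The minimum degree
  condition says that everybody has at most one stranger. A prolongation of the triangle is
  connected, because it has a Hamiltonian path, and it contains a triangle. For any such graph \<open>X\<close> the graph \<open>FS(X, Y)\<close> is connected, for the following reason.

  Call two positions exchangeable if from every placement one can reach the placement in which just
  the occupants of these two positions have traded places.

  \<^item> Two positions of a triangle are exchangeable. If their occupants are strangers, the person on the
    third position is a friend of both, so three moves through that position do the exchange.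
  \<^item> If \<open>a\<close>, \<open>b\<close>, \<open>c\<close> is a path in \<open>X\<close> and \<open>a\<close>, \<open>b\<close> are exchangeable, then so are \<open>b\<close>, \<open>c\<close>. If the
    occupants of \<open>b\<close> and \<open>c\<close> are strangers, both are friends of the person on \<open>a\<close>; that person moves
    over to \<open>c\<close>, the two strangers are exchanged on \<open>a\<close> and \<open>b\<close>, and the person moves back.

  Exchangeability is transitive, so it spreads from the triangle along the edges of the connected
  graph \<open>X\<close> until all pairs of positions are exchangeable. Transpositions generate the symmetric
  group, hence every placement can be reached from every other.
\<close>

section \<open>Reachability and transpositions\<close>

lemma connected_if_all_reachable:
  assumes "pair_graph G" "pverts G \<noteq> {}"
    and "\<And>u v. u \<in> pverts G \<Longrightarrow> v \<in> pverts G \<Longrightarrow> reachable (with_proj G) u v"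
  shows "connected (with_proj G)"
proof -
  interpret G: pair_graph G by fact
  show ?thesis
    unfolding connected_def strongly_connected_def
    using assms(2,3) by (simp add: G.reachable_mk_symmetric_eq[OF G.pair_sym_arcs])
qed

lemma pverts_fs_graph: "pverts (fs_graph X Y) = fs_verts X Y"
  by (simp add: fs_graph_def)

text \<open>
  The next two identities record the net effect of the walks by which two strangers are exchanged:
  around a triangle, and along a path with three vertices.
\<close>

lemma transpose_triangle:
  assumes "distinct [a, b, c]"
  shows "transpose a c \<circ> transpose a b \<circ> transpose b c = transpose a b"
  using assms by (auto simp: fun_eq_iff transpose_def)

lemma transpose_path:
  assumes "distinct [b, c, a]"
  shows "transpose a b \<circ> transpose b c \<circ> transpose a b \<circ> transpose b c \<circ> transpose a b =
    transpose b c"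
proof -
  have "transpose a b \<circ> transpose b c \<circ> transpose a b = transpose a c"
    using assms by (intro transpose_comp_triple) auto
  then show ?thesis
    using assms transpose_triangle[of c b a] by (auto simp: transpose_commute)
qed

section \<open>Moves in a graph where everybody has at most one stranger\<close>

locale at_most_one_stranger = X: pair_graph X + Y: pair_graph Y
  for X :: "'a pair_pre_digraph" and Y :: "'b pair_pre_digraph" +
  assumes friend_of_one: "\<lbrakk>u \<in> pverts Y; v \<in> pverts Y; w \<in> pverts Y; distinct [u, v, w]\<rbrakk>
    \<Longrightarrow> (u, v) \<in> parcs Y \<or> (u, w) \<in> parcs Y"
begin

sublocale FS: pair_graph "fs_graph X Y"
  by (rule pair_graph_fs_graph) unfold_locales

abbreviation reaches :: "('a \<Rightarrow> 'b) \<Rightarrow> ('a \<Rightarrow> 'b) \<Rightarrow> bool" where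
  "reaches \<sigma> \<tau> \<equiv> reachable (with_proj (fs_graph X Y)) \<sigma> \<tau>"

definition exchangeable :: "'a \<Rightarrow> 'a \<Rightarrow> bool" where
  "exchangeable a b \<longleftrightarrow> (\<forall>\<sigma> \<in> fs_verts X Y. reaches \<sigma> (\<sigma> \<circ> transpose a b))"

lemma exchangeableD:
  "exchangeable a b \<Longrightarrow> \<sigma> \<in> fs_verts X Y \<Longrightarrow> reaches \<sigma> (\<sigma> \<circ> transpose a b)"
  by (simp add: exchangeable_def)

lemma fs_verts_transpose:
  assumes "\<sigma> \<in> fs_verts X Y" "a \<in> pverts X" "b \<in> pverts X"
  shows "\<sigma> \<circ> transpose a b \<in> fs_verts X Y"
proof -
  have "bij_betw (transpose a b) (pverts X) (pverts X)"
    using assms by (intro permutes_imp_bij permutes_swap_id)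
  moreover have "bij_betw \<sigma> (pverts X) (pverts Y)" using assms(1) by (simp add: fs_verts_def)
  ultimately have "bij_betw (\<sigma> \<circ> transpose a b) (pverts X) (pverts Y)" by (rule bij_betw_trans)
  then show ?thesis
    using assms by (auto simp: fs_verts_def extensional_def transpose_def)
qed

lemma fs_verts_in_Y: "\<sigma> \<in> fs_verts X Y \<Longrightarrow> a \<in> pverts X \<Longrightarrow> \<sigma> a \<in> pverts Y"
  by (auto simp: fs_verts_def bij_betw_def)

lemma fs_verts_eq_iff:
  "\<sigma> \<in> fs_verts X Y \<Longrightarrow> a \<in> pverts X \<Longrightarrow> b \<in> pverts X \<Longrightarrow> \<sigma> a = \<sigma> b \<longleftrightarrow> a = b"
  by (auto simp: fs_verts_def bij_betw_def dest: inj_onD)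

text \<open>
  Each of two people who are strangers to one another has thereby met the bound of one stranger, so
  any third person is a friend of both.
\<close>

lemma friends_of_third:
  assumes \<sigma>: "\<sigma> \<in> fs_verts X Y" and pos: "a \<in> pverts X" "b \<in> pverts X" "c \<in> pverts X"
    and "distinct [a, b, c]" "(\<sigma> a, \<sigma> b) \<notin> parcs Y"
  shows "(\<sigma> a, \<sigma> c) \<in> parcs Y" "(\<sigma> b, \<sigma> c) \<in> parcs Y"
        "(\<sigma> c, \<sigma> a) \<in> parcs Y" "(\<sigma> c, \<sigma> b) \<in> parcs Y"
proof -
  have "distinct [\<sigma> a, \<sigma> b, \<sigma> c]" using assms by (simp add: fs_verts_eq_iff)
  moreover have "\<sigma> a \<in> pverts Y" "\<sigma> b \<in> pverts Y" "\<sigma> c \<in> pverts Y"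
    using \<sigma> pos by (simp_all add: fs_verts_in_Y)
  ultimately show "(\<sigma> a, \<sigma> c) \<in> parcs Y" "(\<sigma> b, \<sigma> c) \<in> parcs Y"
    using friend_of_one[of "\<sigma> a" "\<sigma> b" "\<sigma> c"] friend_of_one[of "\<sigma> b" "\<sigma> a" "\<sigma> c"] assms(6)
      Y.arcs_symmetric by auto
  then show "(\<sigma> c, \<sigma> a) \<in> parcs Y" "(\<sigma> c, \<sigma> b) \<in> parcs Y"
    by (auto intro: Y.arcs_symmetric)
qed

lemma reaches_move:
  assumes "\<sigma> \<in> fs_verts X Y" "(a, b) \<in> parcs X" "(\<sigma> a, \<sigma> b) \<in> parcs Y"
  shows "reaches \<sigma> (\<sigma> \<circ> transpose a b)"
proof (rule FS.reachable_adjI)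
  have "\<sigma> \<circ> transpose a b \<in> fs_verts X Y"
    using assms by (auto intro: fs_verts_transpose X.in_arcsD1 X.in_arcsD2)
  moreover have "fs_adj X Y \<sigma> (\<sigma> \<circ> transpose a b)"
    unfolding fs_adj_def using assms(2,3) by (intro exI[of _ a] exI[of _ b]) simp
  ultimately show "(\<sigma>, \<sigma> \<circ> transpose a b) \<in> parcs (fs_graph X Y)"
    using assms(1) by (simp add: fs_graph_def)
qed

section \<open>Exchangeable positions\<close>

lemma exchangeable_refl: "exchangeable a a"
  by (simp add: exchangeable_def pverts_fs_graph)

lemma exchangeable_sym: "exchangeable a b \<Longrightarrow> exchangeable b a"
  by (simp add: exchangeable_def transpose_commute)

text \<open>
  The transposition of \<open>a\<close> and \<open>c\<close> is the conjugate of that of \<open>b\<close> and \<open>c\<close> by that of \<open>a\<close> and \<open>b\<close>.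
\<close>

lemma exchangeable_trans:
  assumes ab: "exchangeable a b" and bc: "exchangeable b c"
    and pos: "a \<in> pverts X" "b \<in> pverts X" "c \<in> pverts X"
  shows "exchangeable a c"
proof (cases "distinct [a, b, c]")
  case False
  then show ?thesis using ab bc exchangeable_refl by auto
next
  case True
  show ?thesis
    unfolding exchangeable_def
  proof
    fix \<sigma> assume \<sigma>: "\<sigma> \<in> fs_verts X Y"
    define \<sigma>1 where "\<sigma>1 = \<sigma> \<circ> transpose a b"
    define \<sigma>2 where "\<sigma>2 = \<sigma>1 \<circ> transpose b c"
    have \<sigma>1: "\<sigma>1 \<in> fs_verts X Y" and \<sigma>2: "\<sigma>2 \<in> fs_verts X Y"
      using \<sigma> pos by (simp_all add: \<sigma>1_def \<sigma>2_def fs_verts_transpose)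
    have "reaches \<sigma> \<sigma>1" unfolding \<sigma>1_def using ab \<sigma> by (rule exchangeableD)
    also have "reaches \<sigma>1 \<sigma>2" unfolding \<sigma>2_def using bc \<sigma>1 by (rule exchangeableD)
    also have "reaches \<sigma>2 (\<sigma>2 \<circ> transpose a b)" using ab \<sigma>2 by (rule exchangeableD)
    also have "\<sigma>2 \<circ> transpose a b = \<sigma> \<circ> transpose a c"
      unfolding \<sigma>1_def \<sigma>2_def using True transpose_comp_triple[of a c b] by (simp add: comp_assoc)
    finally show "reaches \<sigma> (\<sigma> \<circ> transpose a c)" .
  qed
qed

text \<open>
  With strangers \<open>u\<close>, \<open>v\<close> on \<open>a\<close>, \<open>b\<close> and their common friend \<open>w\<close> on \<open>c\<close>, the placements run through
  \<open>uvw\<close>, \<open>wvu\<close>, \<open>vwu\<close>, \<open>vuw\<close> (occupants of \<open>a\<close>, \<open>b\<close>, \<open>c\<close> in this order). In each move \<open>w\<close> takes part.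
\<close>

lemma exchangeable_triangle:
  assumes edges: "(a, b) \<in> parcs X" "(b, c) \<in> parcs X" "(a, c) \<in> parcs X"
  shows "exchangeable a b"
  unfolding exchangeable_def
proof
  fix \<sigma> assume \<sigma>: "\<sigma> \<in> fs_verts X Y"
  have pos: "a \<in> pverts X" "b \<in> pverts X" "c \<in> pverts X" and dist: "distinct [a, b, c]"
    using edges by (auto dest: X.in_arcsD1 X.in_arcsD2 X.no_loops')
  show "reaches \<sigma> (\<sigma> \<circ> transpose a b)"
  proof (cases "(\<sigma> a, \<sigma> b) \<in> parcs Y")
    case True
    with \<sigma> edges(1) show ?thesis by (rule reaches_move)
  next
    case False
    note friends = friends_of_third[OF \<sigma> pos dist False]
    define \<sigma>1 where "\<sigma>1 = \<sigma> \<circ> transpose a c"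
    define \<sigma>2 where "\<sigma>2 = \<sigma>1 \<circ> transpose a b"
    have \<sigma>1: "\<sigma>1 \<in> fs_verts X Y" and \<sigma>2: "\<sigma>2 \<in> fs_verts X Y"
      using \<sigma> pos by (simp_all add: \<sigma>1_def \<sigma>2_def fs_verts_transpose)
    have occupants: "\<sigma>1 a = \<sigma> c" "\<sigma>1 b = \<sigma> b" "\<sigma>2 b = \<sigma> c" "\<sigma>2 c = \<sigma> a"
      using dist by (auto simp: \<sigma>1_def \<sigma>2_def transpose_def)
    have "reaches \<sigma> \<sigma>1"
      unfolding \<sigma>1_def using \<sigma> edges(3) friends(1) by (rule reaches_move)
    also have "reaches \<sigma>1 \<sigma>2"
      unfolding \<sigma>2_def using \<sigma>1 edges(1) by (rule reaches_move) (simp add: occupants friends)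
    also have "reaches \<sigma>2 (\<sigma>2 \<circ> transpose b c)"
      using \<sigma>2 edges(2) by (rule reaches_move) (simp add: occupants friends)
    also have "\<sigma>2 \<circ> transpose b c = \<sigma> \<circ> transpose a b"
      unfolding \<sigma>1_def \<sigma>2_def using transpose_triangle[OF dist] by (simp only: comp_assoc)
    finally show ?thesis .
  qed
qed

text \<open>
  With strangers \<open>u\<close>, \<open>v\<close> on \<open>b\<close>, \<open>c\<close> and their common friend \<open>w\<close> on \<open>a\<close>, the placements run through
  \<open>wuv\<close>, \<open>uwv\<close>, \<open>uvw\<close>, \<open>vuw\<close>, \<open>vwu\<close>, \<open>wvu\<close> (occupants of \<open>a\<close>, \<open>b\<close>, \<open>c\<close> in this order). The
  middle step is the exchange on \<open>a\<close> and \<open>b\<close>; in each of the other four steps \<open>w\<close> trades places with a friend.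
\<close>

lemma exchangeable_next_edge:
  assumes ab: "exchangeable a b" and edges: "(a, b) \<in> parcs X" "(b, c) \<in> parcs X"
  shows "exchangeable b c"
proof (cases "a = c")
  case True
  with ab show ?thesis by (simp add: exchangeable_sym)
next
  case False
  show ?thesis
    unfolding exchangeable_def
  proof
    fix \<sigma> assume \<sigma>: "\<sigma> \<in> fs_verts X Y"
    have pos: "b \<in> pverts X" "c \<in> pverts X" "a \<in> pverts X" and dist: "distinct [b, c, a]"
      using edges False by (auto dest: X.in_arcsD1 X.in_arcsD2 X.no_loops')
    show "reaches \<sigma> (\<sigma> \<circ> transpose b c)"
    proof (cases "(\<sigma> b, \<sigma> c) \<in> parcs Y")
      case True
      with \<sigma> edges(2) show ?thesis by (rule reaches_move)
    next
      case False
      note friends = friends_of_third[OF \<sigma> pos dist False]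
      define \<sigma>1 where "\<sigma>1 = \<sigma> \<circ> transpose a b"
      define \<sigma>2 where "\<sigma>2 = \<sigma>1 \<circ> transpose b c"
      define \<sigma>3 where "\<sigma>3 = \<sigma>2 \<circ> transpose a b"
      define \<sigma>4 where "\<sigma>4 = \<sigma>3 \<circ> transpose b c"
      note defs = \<sigma>1_def \<sigma>2_def \<sigma>3_def \<sigma>4_def
      have \<sigma>1: "\<sigma>1 \<in> fs_verts X Y" and \<sigma>2: "\<sigma>2 \<in> fs_verts X Y"
        and \<sigma>3: "\<sigma>3 \<in> fs_verts X Y" and \<sigma>4: "\<sigma>4 \<in> fs_verts X Y"
        using \<sigma> pos by (simp_all add: defs fs_verts_transpose)
      have occupants: "\<sigma>1 b = \<sigma> a" "\<sigma>1 c = \<sigma> c" "\<sigma>3 b = \<sigma> b" "\<sigma>3 c = \<sigma> a" "\<sigma>4 a = \<sigma> c" "\<sigma>4 b = \<sigma> a"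
        using dist by (auto simp: defs transpose_def)
      have "reaches \<sigma> \<sigma>1"
        unfolding \<sigma>1_def using \<sigma> edges(1) friends(3) by (rule reaches_move)
      also have "reaches \<sigma>1 \<sigma>2"
        unfolding \<sigma>2_def using \<sigma>1 edges(2) by (rule reaches_move) (simp add: occupants friends)
      also have "reaches \<sigma>2 \<sigma>3"
        unfolding \<sigma>3_def using ab \<sigma>2 by (rule exchangeableD)
      also have "reaches \<sigma>3 \<sigma>4"
        unfolding \<sigma>4_def using \<sigma>3 edges(2) by (rule reaches_move) (simp add: occupants friends)
      also have "reaches \<sigma>4 (\<sigma>4 \<circ> transpose a b)"
        using \<sigma>4 edges(1) by (rule reaches_move) (simp add: occupants friends)
      also have "\<sigma>4 \<circ> transpose a b = \<sigma> \<circ> transpose b c"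
        unfolding defs using transpose_path[OF dist] by (simp only: comp_assoc)
      finally show ?thesis .
    qed
  qed
qed

text \<open>
  Walking away from the triangle, one carries along an edge with exchangeable ends that leads into
  the current vertex: it makes the ends of the next edge exchangeable.
\<close>

lemma all_exchangeable:
  assumes conn: "connected (with_proj X)"
    and triangle: "(a, b) \<in> parcs X" "(b, c) \<in> parcs X" "(a, c) \<in> parcs X"
    and "x \<in> pverts X" "y \<in> pverts X"
  shows "exchangeable x y"
proof -
  have a: "a \<in> pverts X" using triangle by (auto dest: X.in_arcsD1)
  have from_a: "exchangeable a v" if "v \<in> pverts X" for v
  proof -
    have "strongly_connected (with_proj X)"
      using X.pair_sym_arcs conn by (rule X.symmetric_connected_imp_strongly_connected)
    then have "reachable (with_proj X) a v"
      using a that by (simp add: strongly_connected_def)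
    then have "exchangeable a v \<and> (\<exists>u. (u, v) \<in> parcs X \<and> exchangeable u v)"
    proof (induction rule: X.reachable_induct)
      case base
      have "exchangeable b a"
        using exchangeable_triangle[OF triangle] by (rule exchangeable_sym)
      moreover have "(b, a) \<in> parcs X" using triangle(1) by (rule X.arcs_symmetric)
      ultimately show ?case using exchangeable_refl by blast
    next
      case (step x y)
      then have xy: "(x, y) \<in> parcs X" by simp
      with step.IH have "exchangeable x y" using exchangeable_next_edge by blast
      moreover from this have "exchangeable a y"
        using step.IH exchangeable_trans a X.wellformed'[OF xy] by blast
      ultimately show ?case using xy by blast
    qed
    then show ?thesis by simp
  qed
  show ?thesis
    using exchangeable_sym[OF from_a] from_a assms(5) a assms(6)
    by (rule exchangeable_trans) fact+
qed

section \<open>Connectedness\<close>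

lemma reaches_permuted:
  assumes all: "\<And>x y. x \<in> pverts X \<Longrightarrow> y \<in> pverts X \<Longrightarrow> exchangeable x y"
    and "p permutes pverts X" "\<sigma> \<in> fs_verts X Y"
  shows "reaches \<sigma> (\<sigma> \<circ> p)"
  using assms(2) X.pair_finite_verts assms(3)
proof (induction p arbitrary: \<sigma> rule: permutes_induct)
  case id
  then show ?case by (simp add: pverts_fs_graph)
next
  case (swap a b p)
  have "reaches \<sigma> (\<sigma> \<circ> transpose a b)"
    using all swap by (blast intro: exchangeableD)
  also have "reaches \<dots> ((\<sigma> \<circ> transpose a b) \<circ> p)"
    using swap by (blast intro: fs_verts_transpose)
  finally show ?case by (simp only: comp_assoc)
qed

lemma fs_verts_permuted:
  assumes \<sigma>: "\<sigma> \<in> fs_verts X Y" and \<tau>: "\<tau> \<in> fs_verts X Y"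
  obtains p where "p permutes pverts X" "\<tau> = \<sigma> \<circ> p"
proof -
  define p where "p x = (if x \<in> pverts X then inv_into (pverts X) \<sigma> (\<tau> x) else x)" for x
  have bij: "bij_betw \<sigma> (pverts X) (pverts Y)" "bij_betw \<tau> (pverts X) (pverts Y)"
    using \<sigma> \<tau> by (simp_all add: fs_verts_def)
  have "bij_betw (inv_into (pverts X) \<sigma> \<circ> \<tau>) (pverts X) (pverts X)"
    using bij by (blast intro: bij_betw_trans bij_betw_inv_into)
  then have "bij_betw p (pverts X) (pverts X)"
    by (rule iffD1[OF bij_betw_cong, rotated]) (simp add: p_def)
  then have "p permutes pverts X"
    by (rule bij_imp_permutes) (simp add: p_def)
  moreover have "\<tau> = \<sigma> \<circ> p"
  proof
    fix x
    show "\<tau> x = (\<sigma> \<circ> p) x"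
    proof (cases "x \<in> pverts X")
      case True
      then have "\<tau> x \<in> pverts Y" using bij(2) by (rule bij_betw_apply[rotated])
      then show ?thesis using True bij(1) by (simp add: p_def bij_betw_inv_into_right)
    next
      case False
      then show ?thesis using \<sigma> \<tau> by (simp add: p_def fs_verts_def extensional_def)
    qed
  qed
  ultimately show ?thesis by (rule that)
qed

theorem connected_fs_graph:
  assumes "connected (with_proj X)"
    and "(a, b) \<in> parcs X" "(b, c) \<in> parcs X" "(a, c) \<in> parcs X"
    and card: "card (pverts Y) = card (pverts X)"
  shows "connected (with_proj (fs_graph X Y))"
proof -
  have reaches: "reaches \<sigma> \<tau>" if \<sigma>: "\<sigma> \<in> fs_verts X Y" and \<tau>: "\<tau> \<in> fs_verts X Y" for \<sigma> \<tau>
  proof -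
    obtain p where p: "p permutes pverts X" and \<tau>_eq: "\<tau> = \<sigma> \<circ> p"
      using \<sigma> \<tau> by (rule fs_verts_permuted)
    show ?thesis
      unfolding \<tau>_eq using _ p \<sigma>
    proof (rule reaches_permuted)
      fix x y assume "x \<in> pverts X" "y \<in> pverts X"
      with assms(1-4) show "exchangeable x y" by (rule all_exchangeable)
    qed
  qed
  have nonempty: "fs_verts X Y \<noteq> {}"
  proof -
    obtain f where "bij_betw f (pverts X) (pverts Y)"
      using finite_same_card_bij[OF X.pair_finite_verts Y.pair_finite_verts] card by auto
    then have "restrict f (pverts X) \<in> fs_verts X Y" by (simp add: fs_verts_def)
    then show ?thesis by blast
  qed
  show ?thesis
  proof (rule connected_if_all_reachable)
    show "pair_graph (fs_graph X Y)" by (rule FS.pair_graph)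
  qed (simp_all add: pverts_fs_graph nonempty reaches)
qed

end

text \<open>
  A vertex with two non-neighbours besides itself would have at most \<open>card (pverts Y) - 3\<close> neighbours.
\<close>

lemma friend_of_one_if_min_degree:
  assumes Y: "pair_graph Y" and deg: "min_degree Y \<ge> card (pverts Y) - 2"
    and "u \<in> pverts Y" "v \<in> pverts Y" "w \<in> pverts Y" "distinct [u, v, w]"
  shows "(u, v) \<in> parcs Y \<or> (u, w) \<in> parcs Y"
proof (rule ccontr)
  assume no_edge: "\<not> ?thesis"
  interpret Y: pair_graph Y by fact
  have fin: "finite (pverts Y)" by (rule Y.pair_finite_verts)
  have "out_arcs (with_proj Y) u \<subseteq> Pair u ` (pverts Y - {u, v, w})"
    using no_edge by (auto simp: image_iff dest: Y.in_arcsD2 Y.no_loops')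
  then have "out_degree (with_proj Y) u \<le> card (Pair u ` (pverts Y - {u, v, w}))"
    unfolding out_degree_def using fin by (intro card_mono) auto
  also have "\<dots> \<le> card (pverts Y - {u, v, w})"
    using fin by (intro card_image_le) simp
  also have "\<dots> = card (pverts Y) - 3"
    using assms by (simp add: card_Diff_subset)
  finally have "out_degree (with_proj Y) u \<le> card (pverts Y) - 3" .
  moreover have "min_degree Y \<le> out_degree (with_proj Y) u"
    unfolding min_degree_def using fin assms(3) by (intro Min_le) auto
  moreover have "card {u, v, w} \<le> card (pverts Y)"
    using assms fin by (intro card_mono) auto
  ultimately show False using deg assms(6) by simp
qed

section \<open>Prolongations\<close>

lemma connected_path_graph:
  assumes "n > 0"
  shows "connected (with_proj (path_graph n))"
proof -
  interpret P: pair_graph "path_graph n" by (rule pair_graph_path_graph)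
  have from_0: "reachable (with_proj (path_graph n)) 0 i" if "i < n" for i
    using that
  proof (induction i)
    case 0
    then have "0 \<in> pverts (path_graph n)" by (simp add: path_graph_def)
    then show ?case by simp
  next
    case (Suc i)
    then have "reachable (with_proj (path_graph n)) 0 i" by simp
    also have "(i, Suc i) \<in> parcs (path_graph n)"
      using Suc by (simp add: path_graph_def)
    finally show ?case by simp
  qed
  have "reachable (with_proj (path_graph n)) i j" if "i < n" "j < n" for i j
    using P.reachable_trans[OF symmetric_reachable[OF P.pair_sym_arcs from_0] from_0] that .
  moreover have "pverts (path_graph n) = {..<n}" by (simp add: path_graph_def)
  ultimately show ?thesis
    using assms by (intro connected_if_all_reachable pair_graph_path_graph) auto
qed

lemma card_verts_digraph_iso: "digraph_iso G H \<Longrightarrow> card (verts G) = card (verts H)"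
  by (auto simp: digraph_iso_def card_image pre_digraph.digraph_isomorphism_inj_on_verts)

text \<open>
  A Hamiltonian path has as many vertices as the graph, so it is a connected spanning subgraph.
\<close>

lemma connected_if_hamiltonian_path:
  assumes G: "pair_graph G" "pverts G \<noteq> {}" and P: "hamiltonian_path P G"
  shows "connected (with_proj G)"
proof -
  interpret G: pair_graph G by fact
  let ?L = "path_graph (card (pverts G))"
  have sub: "subgraph (with_proj P) (with_proj G)"
    and iso: "digraph_iso (with_proj P) (with_proj ?L)"
    using P by (simp_all add: hamiltonian_path_def)
  interpret L: pair_graph ?L by (rule pair_graph_path_graph)
  have "digraph_iso (with_proj ?L) (with_proj P)"
    using _ iso by (rule digraph_iso_swap) (use sub in \<open>simp add: subgraph_def\<close>)
  then obtain f where "L.digraph_isomorphism f" "with_proj P = app_iso f (with_proj ?L)"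
    by (auto simp: digraph_iso_def)
  moreover have "connected (with_proj ?L)"
    using G by (intro connected_path_graph) (simp add: card_gt_0_iff G.pair_finite_verts)
  ultimately have "connected (with_proj P)"
    by (simp add: L.connectedI_app_iso)
  moreover have "spanning (with_proj P) (with_proj G)"
  proof -
    have "card (pverts P) = card (pverts G)"
      using card_verts_digraph_iso[OF iso] by (simp add: path_graph_def)
    moreover have "pverts P \<subseteq> pverts G" using sub by (simp add: subgraph_def)
    ultimately have "pverts P = pverts G"
      using G.pair_finite_verts by (intro card_subset_eq)
    then show ?thesis using sub by (simp add: spanning_def)
  qed
  ultimately show ?thesis by (intro G.connected_spanning_imp_connected)
qed

text \<open>
  An isomorphism onto \<open>K\<close> maps the arcs of \<open>H\<close> onto those of \<open>K\<close>; by injectivity on the vertices, an arc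
  of \<open>K\<close> can only come from the arc between the two preimages of its ends.
\<close>

lemma arcs_if_digraph_iso_complete:
  assumes K: "complete_digraph n (with_proj K)" and iso: "digraph_iso (with_proj H) (with_proj K)"
    and "x \<in> pverts H" "y \<in> pverts H" "x \<noteq> y"
  shows "(x, y) \<in> parcs H"
proof -
  obtain f where f: "pre_digraph.digraph_isomorphism (with_proj H) f"
    and eq: "with_proj K = app_iso f (with_proj H)"
    using iso by (auto simp: digraph_iso_def)
  interpret H: pair_wf_digraph H
    using f by (simp add: pre_digraph.digraph_isomorphism_def wf_digraph_wp_iff)
  have inj: "iso_verts f u = iso_verts f v \<longleftrightarrow> u = v" if "u \<in> pverts H" "v \<in> pverts H" for u v
    using f that by (simp add: H.iso_verts_eq_iff)
  have "iso_verts f ` pverts H = pverts K"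
    using arg_cong[OF eq, of verts] by simp
  then have "(iso_verts f x, iso_verts f y) \<in> parcs K"
    using K inj assms(3-5) by (auto simp: complete_digraph_pair_def)
  also have "parcs K = (\<lambda>(u, v). (iso_verts f u, iso_verts f v)) ` parcs H"
    using H.arcs_ends_app_iso_eq[OF f] arg_cong[OF eq, of arcs_ends] by simp
  finally obtain u v where uv: "(u, v) \<in> parcs H"
    and "iso_verts f x = iso_verts f u" "iso_verts f y = iso_verts f v"
    by auto
  then have "x = u" "y = v"
    using inj assms(3,4) H.wellformed'[OF uv] by simp_all
  then show ?thesis using uv by simp
qed

lemma triangle_if_prolongation:
  assumes K: "complete_digraph 3 (with_proj K)" and "prolongation G K"
  obtains a b c where "(a, b) \<in> parcs G" "(b, c) \<in> parcs G" "(a, c) \<in> parcs G"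
proof -
  obtain H where sub: "subgraph (with_proj H) (with_proj G)"
    and iso: "digraph_iso (with_proj H) (with_proj K)"
    using assms by (auto simp: prolongation_def)
  have "card (pverts H) = 3"
    using card_verts_digraph_iso[OF iso] K by (simp add: complete_digraph_def)
  then obtain a b c where "pverts H = {a, b, c}" "distinct [a, b, c]"
    by (auto simp: card_3_iff)
  then have "(a, b) \<in> parcs H" "(b, c) \<in> parcs H" "(a, c) \<in> parcs H"
    by (auto intro: arcs_if_digraph_iso_complete[OF K iso])
  moreover have "parcs H \<subseteq> parcs G" using sub by (simp add: subgraph_def)
  ultimately show ?thesis by (intro that) auto
qed

theorem corollary5p4:
  fixes X :: "'c pair_pre_digraph"
    and Xt :: "'a pair_pre_digraph"
    and Yt :: "'b pair_pre_digraph"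
  assumes "complete_digraph 3 (with_proj X)"
    and "prolongation Xt X"
    and "pair_graph Yt"
    and "card (pverts Yt) = card (pverts Xt)"
    and "min_degree Yt \<ge> card (pverts Xt) - 2"
  shows "Digraph_Component.connected (with_proj (fs_graph Xt Yt))"
proof -
  obtain a b c where triangle: "(a, b) \<in> parcs Xt" "(b, c) \<in> parcs Xt" "(a, c) \<in> parcs Xt"
    using assms(1,2) by (rule triangle_if_prolongation)
  have Xt: "pair_graph Xt" using assms(2) by (simp add: prolongation_def)
  then interpret Xt: pair_graph Xt .
  interpret at_most_one_stranger Xt Yt
  proof (intro at_most_one_stranger.intro at_most_one_stranger_axioms.intro Xt assms(3))
    fix u v w
    assume "u \<in> pverts Yt" "v \<in> pverts Yt" "w \<in> pverts Yt" "distinct [u, v, w]"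
    then show "(u, v) \<in> parcs Yt \<or> (u, w) \<in> parcs Yt"
      using assms(3-5) by (intro friend_of_one_if_min_degree) simp_all
  qed
  have "pverts Xt \<noteq> {}" using triangle(1) by (auto dest: Xt.in_arcsD1)
  then have "connected (with_proj Xt)"
    using assms(2) Xt by (auto simp: prolongation_def intro: connected_if_hamiltonian_path)
  then show ?thesis using triangle assms(4) by (rule connected_fs_graph)
qed

end
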